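(* Let $\mathcal{K}\subset\mathbb{R}^N$ be a convex body. Then its circumcenter $C_{\mathcal{K}}$ belongs to the heart $\heartsuit(\mathcal{K})$.
   Context: A convex body in $\mathbb{R}^N$ is a compact convex set with non-empty interior. The circumcenter $C_{\mathcal{K}}$ is the center of the smallest ball containing $\mathcal{K}$. For $\omega\in\mathbb{S}^{N-1}$ (the unit sphere) and $\lambda\in\mathbb{R}$, $T_{\lambda,\omega}$ is the reflection of $\mathbb{R}^N$ in the hyperplane $\{x:\langle x,\omega\rangle=\lambda\}$, and $\mathcal{K}_{\lambda,\omega}=\{x\in\mathcal{K}:\langle x,\omega\rangle\ge\lambda\}$. The maximal folding function is $\mathcal{R}_{\mathcal{K}}(\omega)=\min\{\lambda\in\mathbb{R}: T_{\lambda,\omega}(\mathcal{K}_{\lambda,\omega})\subseteq\mathcal{K}\}$. The heart of $\mathcal{K}$ is $\heartsuit(\mathcal{K})=\{x\in\mathcal{K}:\langle x,\omega\rangle\le\mathcal{R}_{\mathcal{K}}(\omega)\text{ for every }\omega\in\mathbb{S}^{N-1}\}$. *)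

theory Defs
  imports "HOL-Analysis.Analysis"
begin

definition convex_body :: "'a::euclidean_space set \<Rightarrow> bool" where
  "convex_body K \<longleftrightarrow> compact K \<and> convex K \<and> interior K \<noteq> {}"

(* Closed balls. For nonempty K, the inclusion K \<subseteq> cball c r forces r \<ge> 0, so negative radii
   (for which cball is empty) do not interfere. For nonempty bounded K the smallest ball exists
   and is unique, so the description is well-defined. *)
definition is_smallest_ball :: "'a::euclidean_space set \<Rightarrow> 'a \<Rightarrow> real \<Rightarrow> bool" where
  "is_smallest_ball K c r \<longleftrightarrow>
     K \<subseteq> cball c r \<and> (\<forall>c' r'. K \<subseteq> cball c' r' \<longrightarrow> r \<le> r')"

definition circumcenter :: "'a::euclidean_space set \<Rightarrow> 'a" where
  "circumcenter K = (THE c. \<exists>r. is_smallest_ball K c r)"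

(* Reflection in the hyperplane {x. x \<bullet> w = l}; the formula presupposes norm w = 1. *)
definition hyperplane_reflection :: "real \<Rightarrow> 'a::euclidean_space \<Rightarrow> 'a \<Rightarrow> 'a" where
  "hyperplane_reflection l w x = x - (2 * (x \<bullet> w - l)) *\<^sub>R w"

definition cap :: "'a::euclidean_space set \<Rightarrow> real \<Rightarrow> 'a \<Rightarrow> 'a set" where
  "cap K l w = {x \<in> K. x \<bullet> w \<ge> l}"

(* The minimum itself, not an infimum: LEAST is meaningful only where it is attained, as it is
   for nonempty compact K and unit vectors w. *)
definition max_folding :: "'a::euclidean_space set \<Rightarrow> 'a \<Rightarrow> real" where
  "max_folding K w = (LEAST l. hyperplane_reflection l w ` cap K l w \<subseteq> K)"

definition heart :: "'a::euclidean_space set \<Rightarrow> 'a set" where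
  "heart K = {x \<in> K. \<forall>w \<in> sphere 0 1. x \<bullet> w \<le> max_folding K w}"

end

theory Submission
  imports Defs
begin

text \<open>Let \<open>c\<close> be the circumcenter of \<open>K\<close> and \<open>r\<close> its circumradius. The argument rests on the
  uniqueness of \<open>c\<close>: no ball of radius \<open>r\<close> with a different center contains \<open>K\<close>.

  Suppose that for some unit vector \<open>w\<close> and some \<open>l < c \<bullet> w\<close> the cap of \<open>K\<close> beyond the hyperplane
  \<open>x \<bullet> w = l\<close> folds back into \<open>K\<close>. Reflect the smallest ball in that hyperplane, which moves its
  center to a different point \<open>c'\<close>. The new ball still contains \<open>K\<close>: a point of the cap is as far
  from \<open>c'\<close> as its mirror image, which lies in \<open>K\<close>, is from \<open>c\<close>; and a point below the hyperplane
  lies on the same side as \<open>c'\<close>, so it is closer to \<open>c'\<close> than to \<open>c\<close>. This contradicts uniqueness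
  (\<open>circumcenter_below_fold\<close>), so \<open>c \<bullet> w\<close> bounds every admissible \<open>l\<close> from below, in particular the
  least one, which exists by compactness (\<open>max_folding_folds\<close>).

  That \<open>c\<close> lies in \<open>K\<close> is the projection argument: moving the center to the nearest point of \<open>K\<close>
  would strictly shorten all distances to points of \<open>K\<close>.\<close>

section \<open>The smallest enclosing ball\<close>

text \<open>The pairs \<open>(c, r)\<close> of admissible centers and radii form a closed set. Once \<open>r\<close> is bounded, so
  is \<open>c\<close>, because the ball has to reach a fixed point of \<open>K\<close>; hence the least radius is attained.\<close>

lemma smallest_ball_exists:
  fixes K :: "'a::euclidean_space set"
  assumes "bounded K" "K \<noteq> {}"
  shows "\<exists>c r. is_smallest_ball K c r"
proof -
  obtain a where a: "a \<in> K"
    using assms(2) by blast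
  obtain e where "\<forall>x\<in>K. dist a x \<le> e"
    using iffD1[OF bounded_any_center[where a = a] assms(1)] by (rule exE)
  then have e: "K \<subseteq> cball a e"
    by auto
  define P where "P = (\<Inter>x\<in>K. {p :: 'a \<times> real. dist (fst p) x \<le> snd p}) \<inter> {p. snd p \<le> e}"
  have P_iff: "(c, r) \<in> P \<longleftrightarrow> K \<subseteq> cball c r \<and> r \<le> e" for c r
    by (auto simp: P_def subset_iff)
  have "closed P"
    unfolding P_def
    by (intro closed_Int closed_INT ballI closed_Collect_le continuous_intros)
  moreover have "bounded P"
  proof (rule bounded_subset)
    show "bounded (cball a e \<times> {0..e})"
      by (intro bounded_Times bounded_cball bounded_closed_interval)
    show "P \<subseteq> cball a e \<times> {0..e}"
    proof (clarify)
      fix c r assume "(c, r) \<in> P"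
      then have "dist c a \<le> r" "r \<le> e"
        using a by (auto simp: P_iff subset_iff)
      then show "c \<in> cball a e \<and> r \<in> {0..e}"
        using zero_le_dist[of c a] by (auto simp: dist_commute simp del: zero_le_dist)
    qed
  qed
  ultimately have "compact P"
    by (simp add: compact_eq_bounded_closed)
  moreover have "P \<noteq> {}"
    using e P_iff by blast
  moreover have "continuous_on P snd"
    by (intro continuous_intros)
  ultimately obtain p where p: "p \<in> P" "\<And>q. q \<in> P \<Longrightarrow> snd p \<le> snd q"
    using continuous_attains_inf[of P snd] by blast
  obtain c r where cr: "p = (c, r)"
    by (cases p)
  have "is_smallest_ball K c r"
    unfolding is_smallest_ball_def
  proof (intro conjI allI impI)
    show "K \<subseteq> cball c r"
      using p(1) by (simp add: cr P_iff)
    fix c' r' assume "K \<subseteq> cball c' r'"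
    then have "r \<le> r'" if "r' \<le> e"
      using p(2)[of "(c', r')"] that by (simp add: cr P_iff)
    moreover have "r \<le> e"
      using p(1) by (simp add: cr P_iff)
    ultimately show "r \<le> r'"
      by linarith
  qed
  then show ?thesis
    by blast
qed

text \<open>Both uniqueness of the center and its membership in \<open>K\<close> are obtained by exhibiting a point \<open>p\<close>
  whose squared distances to \<open>K\<close> lie uniformly below the squared radius.\<close>

lemma smallest_ball_no_uniformly_closer_point:
  assumes "is_smallest_ball K c r" "K \<noteq> {}"
    and closer: "\<And>x. x \<in> K \<Longrightarrow> (dist p x)\<^sup>2 + d \<le> r\<^sup>2"
  shows "d \<le> 0"
proof (rule ccontr)
  assume "\<not> d \<le> 0"
  then have d: "d > 0" by simp
  obtain a where a: "a \<in> K" "dist c a \<le> r"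
    using assms(1,2) by (auto simp: is_smallest_ball_def subset_iff)
  have r: "0 \<le> r"
    using a(2) zero_le_dist order_trans by blast
  have "K \<subseteq> cball p (sqrt (r\<^sup>2 - d))"
    using closer by (force intro: real_le_rsqrt)
  then have "r \<le> sqrt (r\<^sup>2 - d)"
    using assms(1) by (auto simp: is_smallest_ball_def)
  moreover have "sqrt (r\<^sup>2 - d) < sqrt (r\<^sup>2)"
    using d by (intro real_sqrt_less_mono) simp
  ultimately show False
    using r by simp
qed

text \<open>By the parallelogram law, the intersection of two distinct balls of radius \<open>r\<close> lies in a smaller
  ball around the midpoint of their centers.\<close>

lemma smallest_ball_center_unique:
  fixes K :: "'a::euclidean_space set"
  assumes c: "is_smallest_ball K c r" and "K \<noteq> {}" and c': "K \<subseteq> cball c' r"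
  shows "c' = c"
proof -
  have "(dist (midpoint c c') x)\<^sup>2 + (dist c c')\<^sup>2 / 4 \<le> r\<^sup>2" if "x \<in> K" for x
  proof -
    have "dist c x \<le> r" "dist c' x \<le> r"
      using c c' that by (auto simp: is_smallest_ball_def)
    then have "(dist c x)\<^sup>2 \<le> r\<^sup>2" "(dist c' x)\<^sup>2 \<le> r\<^sup>2"
      by (auto intro: power_mono)
    moreover have "(dist (midpoint c c') x)\<^sup>2 + (dist c c')\<^sup>2 / 4
        = ((dist c x)\<^sup>2 + (dist c' x)\<^sup>2) / 2"
      by (simp add: midpoint_def dist_norm power2_norm_eq_inner inner_simps inner_commute field_simps)
    ultimately show ?thesis
      by simp
  qed
  then have "(dist c c')\<^sup>2 / 4 \<le> 0"
    by (rule smallest_ball_no_uniformly_closer_point[OF c \<open>K \<noteq> {}\<close>])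
  then show ?thesis
    by simp
qed

text \<open>If \<open>c\<close> lay outside \<open>K\<close>, then at the point of \<open>K\<close> nearest to \<open>c\<close> the directions to \<open>c\<close> and to any
  other point of \<open>K\<close> would form a non-acute angle. By the law of cosines that point would be closer
  than \<open>c\<close> to all of \<open>K\<close>, by a uniform amount in the squared distances.\<close>

lemma smallest_ball_center_in_convex:
  fixes K :: "'a::euclidean_space set"
  assumes c: "is_smallest_ball K c r" and "closed K" "convex K" "K \<noteq> {}"
  shows "c \<in> K"
proof -
  define p where "p = closest_point K c"
  have p: "p \<in> K"
    unfolding p_def using assms by (intro closest_point_in_set)
  have "(dist p x)\<^sup>2 + (dist c p)\<^sup>2 \<le> r\<^sup>2" if "x \<in> K" for x
  proof -
    have "(c - p) \<bullet> (x - p) \<le> 0"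
      unfolding p_def using assms that by (intro closest_point_dot)
    moreover have "(dist p x)\<^sup>2 + (dist c p)\<^sup>2 = (dist c x)\<^sup>2 + 2 * ((c - p) \<bullet> (x - p))"
      by (simp add: dist_norm power2_norm_eq_inner inner_simps inner_commute)
    moreover have "dist c x \<le> r"
      using c that by (auto simp: is_smallest_ball_def)
    then have "(dist c x)\<^sup>2 \<le> r\<^sup>2"
      by (simp add: power_mono)
    ultimately show ?thesis
      by simp
  qed
  then have "(dist c p)\<^sup>2 \<le> 0"
    by (rule smallest_ball_no_uniformly_closer_point[OF c \<open>K \<noteq> {}\<close>])
  then show ?thesis
    using p by simp
qed

lemma circumcenter_is_smallest_ball:
  fixes K :: "'a::euclidean_space set"
  assumes "bounded K" "K \<noteq> {}"
  shows "\<exists>r. is_smallest_ball K (circumcenter K) r"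
  unfolding circumcenter_def
proof (rule theI')
  have "c' = c" if "is_smallest_ball K c r" "is_smallest_ball K c' r'" for c c' r r'
  proof -
    have "r' = r"
      using that unfolding is_smallest_ball_def by (blast intro: antisym)
    then have "K \<subseteq> cball c' r"
      using that by (simp add: is_smallest_ball_def)
    then show ?thesis
      by (rule smallest_ball_center_unique[OF that(1) assms(2)])
  qed
  then show "\<exists>!c. \<exists>r. is_smallest_ball K c r"
    using smallest_ball_exists[OF assms] by blast
qed

section \<open>Folding\<close>

lemma hyperplane_reflection_inner:
  assumes "norm w = 1"
  shows "hyperplane_reflection l w x \<bullet> w = 2 * l - x \<bullet> w"
  using assms by (simp add: hyperplane_reflection_def inner_simps dot_square_norm)

lemma dist_hyperplane_reflection_sq:
  assumes "norm w = 1"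
  shows "(dist (hyperplane_reflection l w c) x)\<^sup>2 = (dist c x)\<^sup>2 + 4 * (c \<bullet> w - l) * (x \<bullet> w - l)"
proof -
  have "w \<bullet> w = 1"
    using assms by (simp add: dot_square_norm)
  then show ?thesis
    by (simp add: hyperplane_reflection_def dist_norm power2_norm_eq_inner inner_simps inner_commute
        algebra_simps)
qed

lemma dist_hyperplane_reflection_swap:
  assumes "norm w = 1"
  shows "dist (hyperplane_reflection l w c) x = dist c (hyperplane_reflection l w x)"
proof -
  have "(dist (hyperplane_reflection l w c) x)\<^sup>2 = (dist (hyperplane_reflection l w x) c)\<^sup>2"
    by (simp add: dist_hyperplane_reflection_sq[OF assms] dist_commute[of x c] algebra_simps)
  then have "dist (hyperplane_reflection l w c) x = dist (hyperplane_reflection l w x) c"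
    by simp
  also have "\<dots> = dist c (hyperplane_reflection l w x)"
    by (rule dist_commute)
  finally show ?thesis .
qed

text \<open>The minimum is attained: the admissible levels are bounded below, since a hyperplane below all of \<open>K\<close> would fold \<open>K\<close> off itself, and they form a closed set
  because a point lying on the hyperplane is fixed by the reflection and so imposes no condition.\<close>

lemma max_folding_folds:
  fixes K :: "'a::euclidean_space set"
  assumes K: "compact K" "K \<noteq> {}" and w: "norm w = 1"
  shows "hyperplane_reflection (max_folding K w) w ` cap K (max_folding K w) w \<subseteq> K"
proof -
  define S where "S = {l. hyperplane_reflection l w ` cap K l w \<subseteq> K}"
  have cont: "continuous_on K (\<lambda>x. x \<bullet> w)"
    by (intro continuous_intros)
  obtain lo where lo: "lo \<in> K" "\<And>x. x \<in> K \<Longrightarrow> lo \<bullet> w \<le> x \<bullet> w"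
    using continuous_attains_inf[OF K cont] by blast
  obtain hi where hi: "\<And>x. x \<in> K \<Longrightarrow> x \<bullet> w \<le> hi \<bullet> w"
    using continuous_attains_sup[OF K cont] by blast
  have "hi \<bullet> w + 1 \<in> S"
    using hi by (force simp: S_def cap_def)
  then have nonempty: "S \<noteq> {}"
    by blast
  have lower: "lo \<bullet> w \<le> l" if "l \<in> S" for l
  proof (rule ccontr)
    assume "\<not> lo \<bullet> w \<le> l"
    then have less: "l < lo \<bullet> w" by simp
    with lo(1) that have "hyperplane_reflection l w lo \<in> K"
      by (auto simp: S_def cap_def image_subset_iff)
    then have "lo \<bullet> w \<le> 2 * l - lo \<bullet> w"
      using lo(2) hyperplane_reflection_inner[OF w] by metis
    with less show False by simp
  qed
  then have bdd: "bdd_below S"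
    by (rule bdd_belowI)
  have "S = (\<Inter>x\<in>K. {x \<bullet> w..} \<union> (\<lambda>l. hyperplane_reflection l w x) -` K)"
  proof (intro set_eqI iffI)
    fix l assume "l \<in> S"
    then show "l \<in> (\<Inter>x\<in>K. {x \<bullet> w..} \<union> (\<lambda>l. hyperplane_reflection l w x) -` K)"
      by (force simp: S_def cap_def image_subset_iff)
  next
    fix l assume l: "l \<in> (\<Inter>x\<in>K. {x \<bullet> w..} \<union> (\<lambda>l. hyperplane_reflection l w x) -` K)"
    have "hyperplane_reflection l w x \<in> K" if x: "x \<in> K" "x \<bullet> w \<ge> l" for x
    proof (cases "x \<bullet> w = l")
      case True
      then show ?thesis
        using x by (simp add: hyperplane_reflection_def)
    next
      case False
      then show ?thesis
        using l x by force
    qed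
    then show "l \<in> S"
      by (auto simp: S_def cap_def)
  qed
  moreover have "closed ({x \<bullet> w..} \<union> (\<lambda>l. hyperplane_reflection l w x) -` K)" for x
    using K(1) unfolding hyperplane_reflection_def
    by (intro closed_Un closed_vimage continuous_intros compact_imp_closed closed_atLeast)
  ultimately have "closed S"
    by auto
  then have Inf_in: "Inf S \<in> S"
    using closed_contains_Inf nonempty bdd by blast
  have "max_folding K w = (LEAST l. l \<in> S)"
    by (simp add: max_folding_def S_def)
  also have "\<dots> = Inf S"
    using Inf_in bdd by (intro Least_equality) (auto intro: cInf_lower)
  finally show ?thesis
    using Inf_in by (simp add: S_def)
qed

text \<open>Otherwise the mirror image of the smallest ball would be another ball of least radius: on the cap,
  reflecting the center amounts to reflecting the point, and beyond the hyperplane the reflected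
  center is the nearer one.\<close>

lemma circumcenter_below_fold:
  fixes K :: "'a::euclidean_space set"
  assumes c: "is_smallest_ball K c r" and "K \<noteq> {}" and w: "norm w = 1"
    and fold: "hyperplane_reflection l w ` cap K l w \<subseteq> K"
  shows "c \<bullet> w \<le> l"
proof (rule ccontr)
  assume "\<not> c \<bullet> w \<le> l"
  then have less: "l < c \<bullet> w" by simp
  let ?c' = "hyperplane_reflection l w c"
  have in_ball: "dist c x \<le> r" if "x \<in> K" for x
    using c that by (auto simp: is_smallest_ball_def)
  have "dist ?c' x \<le> r" if x: "x \<in> K" for x
  proof (cases "l \<le> x \<bullet> w")
    case True
    then have "hyperplane_reflection l w x \<in> K"
      using x fold by (auto simp: cap_def)
    then show ?thesis
      using in_ball by (simp add: dist_hyperplane_reflection_swap[OF w])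
  next
    case False
    then have "4 * (c \<bullet> w - l) * (x \<bullet> w - l) \<le> 0"
      using less by (intro mult_nonneg_nonpos) auto
    then have "(dist ?c' x)\<^sup>2 \<le> (dist c x)\<^sup>2"
      by (simp add: dist_hyperplane_reflection_sq[OF w])
    then have "dist ?c' x \<le> dist c x"
      by (rule power2_le_imp_le) simp
    then show ?thesis
      using in_ball[OF x] by simp
  qed
  then have "K \<subseteq> cball ?c' r"
    by auto
  then have "?c' = c"
    by (rule smallest_ball_center_unique[OF c \<open>K \<noteq> {}\<close>])
  then have "2 * l - c \<bullet> w = c \<bullet> w"
    using hyperplane_reflection_inner[OF w] by metis
  with less show False
    by simp
qed

section \<open>The circumcenter lies in the heart\<close>

theorem proposition3p1:
  fixes K :: "(real ^ 'n) set"
  assumes "convex_body K"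
  shows "circumcenter K \<in> heart K"
proof -
  have K: "compact K" "convex K" "K \<noteq> {}"
    using assms by (auto simp: convex_body_def)
  obtain r where r: "is_smallest_ball K (circumcenter K) r"
    using circumcenter_is_smallest_ball compact_imp_bounded K by blast
  have "circumcenter K \<in> K"
    using smallest_ball_center_in_convex[OF r] compact_imp_closed K by blast
  moreover have "circumcenter K \<bullet> w \<le> max_folding K w" if "norm w = 1" for w
    using circumcenter_below_fold[OF r K(3) that max_folding_folds[OF K(1,3) that]] .
  ultimately show ?thesis
    by (simp add: heart_def)
qed

end
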